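(* Let $p_3>0$, $p_5>0$, $\rho>0$, and consider the system $$\mathcal{D}'=-4p_3\mathcal{R}\mathcal{I}+2p_5\rho\,\mathcal{I},\qquad\mathcal{R}'=0,\qquad\mathcal{I}'=4p_3\mathcal{D}\mathcal{R}-2p_5\rho\,\mathcal{D}$$ on $S^2_\rho$. The two points $(\mathcal{D},\mathcal{R},\mathcal{I})=\pm(0,\rho,0)$ are fixed points. If $2p_3>p_5$, then all points in the set $$\Big\{\Big(\sqrt{1-(\tfrac{p_5}{2p_3})^2}\,\rho\cos\eta,\ \tfrac{p_5}{2p_3}\rho,\ \sqrt{1-(\tfrac{p_5}{2p_3})^2}\,\rho\sin\eta\Big):\eta\in\mathbb{R}/2\pi\mathbb{Z}\Big\}$$ are fixed points. Any solution is given by $$\mathcal{D}(\tau)=\mathcal{D}(0)\cos\big(2(2p_3\mathcal{R}(0)-p_5\rho)\tau\big)-\mathcal{I}(0)\sin\big(2(2p_3\mathcal{R}(0)-p_5\rho)\tau\big),\qquad\mathcal{R}(\tau)=\mathcal{R}(0),$$ $$\mathcal{I}(\tau)=\mathcal{D}(0)\sin\big(2(2p_3\mathcal{R}(0)-p_5\rho)\tau\big)+\mathcal{I}(0)\cos\big(2(2p_3\mathcal{R}(0)-p_5\rho)\tau\big).$$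
   Context: $S^2_\rho=\{(x,y,z)\in\mathbb{R}^3: x^2+y^2+z^2=\rho^2\}$; the unknown $(\mathcal{D},\mathcal{R},\mathcal{I})$ is real valued with initial data in $S_\rho^2$, $\tau\in\mathbb{R}$, and the system preserves $S^2_\rho$. *)

theory Defs
  imports "HOL-Analysis.Analysis"
begin

definition S2 :: "real \<Rightarrow> (real \<times> real \<times> real) set" where
  "S2 \<rho> = {(x, y, z). x\<^sup>2 + y\<^sup>2 + z\<^sup>2 = \<rho>\<^sup>2}"

text \<open>The right-hand side of the system, with the unknowns in the order D, R, I.\<close>

definition dri_field ::
  "real \<Rightarrow> real \<Rightarrow> real \<Rightarrow> real \<times> real \<times> real \<Rightarrow> real \<times> real \<times> real" where
  "dri_field p3 p5 \<rho> = (\<lambda>(D, R, I).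
     (- 4 * p3 * R * I + 2 * p5 * \<rho> * I,
      0,
      4 * p3 * D * R - 2 * p5 * \<rho> * D))"

definition dri_fixed_point ::
  "real \<Rightarrow> real \<Rightarrow> real \<Rightarrow> real \<times> real \<times> real \<Rightarrow> bool" where
  "dri_fixed_point p3 p5 \<rho> P \<longleftrightarrow> P \<in> S2 \<rho> \<and> dri_field p3 p5 \<rho> P = 0"

text \<open>Only the initial data are required to lie on the sphere; that the whole trajectory
  stays there is then a consequence of the equations (\<open>dri_solution_in_S2\<close> below).\<close>

definition dri_solution ::
  "real \<Rightarrow> real \<Rightarrow> real \<Rightarrow> (real \<Rightarrow> real \<times> real \<times> real) \<Rightarrow> bool" where
  "dri_solution p3 p5 \<rho> u \<longleftrightarrow>
     u 0 \<in> S2 \<rho> \<and>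
     (\<forall>\<tau>. (u has_vector_derivative dri_field p3 p5 \<rho> (u \<tau>)) (at \<tau>))"

lemma dri_solution_in_S2:
  assumes "dri_solution p3 p5 \<rho> u"
  shows "u \<tau> \<in> S2 \<rho>"
proof -
  have der: "(u has_vector_derivative dri_field p3 p5 \<rho> (u t)) (at t)" for t
    using assms by (simp add: dri_solution_def)
  have orth: "u t \<bullet> dri_field p3 p5 \<rho> (u t) = 0" for t
    by (cases "u t") (simp add: dri_field_def algebra_simps)
  have "((\<lambda>s. u s \<bullet> u s) has_real_derivative 0) (at t)" for t
  proof -
    have "((\<lambda>s. u s \<bullet> u s) has_derivative
        (\<lambda>h. u t \<bullet> (h *\<^sub>R dri_field p3 p5 \<rho> (u t)) + (h *\<^sub>R dri_field p3 p5 \<rho> (u t)) \<bullet> u t)) (at t)"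
      using der[of t] unfolding has_vector_derivative_def
      by (intro has_derivative_inner)
    moreover have "(\<lambda>h. u t \<bullet> (h *\<^sub>R dri_field p3 p5 \<rho> (u t))
        + (h *\<^sub>R dri_field p3 p5 \<rho> (u t)) \<bullet> u t) = (*) 0"
      using orth[of t] by (auto simp: inner_commute)
    ultimately show ?thesis by (simp add: has_field_derivative_def)
  qed
  then have eq: "u \<tau> \<bullet> u \<tau> = u 0 \<bullet> u 0"
    by (intro DERIV_isconst_all[of "\<lambda>s. u s \<bullet> u s"]) auto
  have S2: "P \<in> S2 \<rho> \<longleftrightarrow> P \<bullet> P = \<rho>\<^sup>2" for P
    by (cases P) (simp add: S2_def power2_eq_square add.assoc)
  show ?thesis using assms eq by (simp add: S2 dri_solution_def)
qed

end

theory Submission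
  imports Defs
begin

text \<open>Since R is constant, the system for D and I is the linear rotation with constant angular
  velocity 2(2 p3 R(0) - p5 \<rho>). Uniqueness follows because the coordinates in the co-rotating
  frame have zero derivative.\<close>

lemma has_vector_derivative_triple_iff:
  fixes f g h :: "real \<Rightarrow> real"
  shows "((\<lambda>t. (f t, g t, h t)) has_vector_derivative (a, b, c)) (at t) \<longleftrightarrow>
    (f has_real_derivative a) (at t) \<and> (g has_real_derivative b) (at t) \<and>
    (h has_real_derivative c) (at t)"
proof
  assume "((\<lambda>t. (f t, g t, h t)) has_vector_derivative (a, b, c)) (at t)"
  then have der: "((\<lambda>t. (f t, g t, h t)) has_derivative (\<lambda>x. x *\<^sub>R (a, b, c))) (at t)"
    by (simp add: has_vector_derivative_def)
  show "(f has_real_derivative a) (at t) \<and> (g has_real_derivative b) (at t) \<and>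
    (h has_real_derivative c) (at t)"
    using has_derivative_fst[OF der] has_derivative_fst[OF has_derivative_snd[OF der]]
      has_derivative_snd[OF has_derivative_snd[OF der]]
    by (simp add: has_real_derivative_iff_has_vector_derivative has_vector_derivative_def)
next
  assume "(f has_real_derivative a) (at t) \<and> (g has_real_derivative b) (at t) \<and>
    (h has_real_derivative c) (at t)"
  then show "((\<lambda>t. (f t, g t, h t)) has_vector_derivative (a, b, c)) (at t)"
    by (auto simp: has_real_derivative_iff_has_vector_derivative intro!: has_vector_derivative_Pair)
qed

text \<open>Existence is direct differentiation; uniqueness comes from undoing the rotation. The
  equivalence form lets the theorem be finished by rewriting, with \<open>D\<close> and
  \<open>I\<close> in the roles of \<open>x\<close> and \<open>y\<close>.\<close>

lemma rotation_ode_iff: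
  fixes x y :: "real \<Rightarrow> real"
  shows "(\<forall>t. (x has_real_derivative - w * y t) (at t) \<and> (y has_real_derivative w * x t) (at t)) \<longleftrightarrow>
    (\<forall>t. x t = x 0 * cos (w * t) - y 0 * sin (w * t) \<and>
         y t = x 0 * sin (w * t) + y 0 * cos (w * t))"
    (is "?ode \<longleftrightarrow> ?sol")
proof
  assume ode: ?ode
  \<comment> \<open>\<open>(p, q)\<close> is \<open>(x, y)\<close> turned back by the angle
    \<open>w * t\<close>, so at time 0 it equals \<open>(x 0, y 0)\<close>. The product rule terms
    cancel in pairs.\<close>
  define p q where "p t = x t * cos (w * t) + y t * sin (w * t)"
    and "q t = y t * cos (w * t) - x t * sin (w * t)" for t
  have dx [derivative_intros]: "(x has_real_derivative - w * y t) (at t)"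
    and dy [derivative_intros]: "(y has_real_derivative w * x t) (at t)" for t
    using ode by auto
  have "(p has_real_derivative 0) (at t)" "(q has_real_derivative 0) (at t)" for t
    unfolding p_def q_def by (auto intro!: derivative_eq_intros simp: algebra_simps)
  then have p: "p t = x 0" and q: "q t = y 0" for t
    using DERIV_isconst_all[of p t 0] DERIV_isconst_all[of q t 0] by (simp_all add: p_def q_def)
  show ?sol
  proof
    fix t
    have one: "cos (w * t) * cos (w * t) + sin (w * t) * sin (w * t) = 1"
      using sin_cos_squared_add3 by simp
    \<comment> \<open>Rotating \<open>(p, q)\<close> forward again recovers \<open>(x, y)\<close>.
      With \<open>c\<close> and \<open>s\<close> arbitrary this is a polynomial identity;
      \<open>one\<close> then removes the factor.\<close>
    have rot: "(x * c + y * s) * c - (y * c - x * s) * s = x * (c * c + s * s)"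
      "(x * c + y * s) * s + (y * c - x * s) * c = y * (c * c + s * s)" for x y c s :: real
      by (simp_all add: algebra_simps)
    have "p t * cos (w * t) - q t * sin (w * t) = x t" "p t * sin (w * t) + q t * cos (w * t) = y t"
      unfolding p_def q_def rot one by simp_all
    then show "x t = x 0 * cos (w * t) - y 0 * sin (w * t) \<and>
        y t = x 0 * sin (w * t) + y 0 * cos (w * t)"
      by (simp add: p q)
  qed
next
  assume sol: ?sol
  \<comment> \<open>Naming the initial values keeps \<open>x\<close> and \<open>y\<close> out of the
    right-hand sides below, so that unfolding these equations terminates.\<close>
  define a b where "a = x 0" and "b = y 0"
  have x: "x = (\<lambda>t. a * cos (w * t) - b * sin (w * t))"
    and y: "y = (\<lambda>t. a * sin (w * t) + b * cos (w * t))"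
    unfolding a_def b_def by (rule ext, use sol in blast)+
  show ?ode
    unfolding x y by (auto intro!: derivative_eq_intros simp: algebra_simps)
qed

text \<open>Once \<open>R\<close> is frozen at \<open>R 0\<close>, the quadratic terms become linear
  in \<open>D\<close> and \<open>I\<close>, with the constant coefficient \<open>w\<close>.\<close>

lemma dri_solution_iff:
  fixes D R I :: "real \<Rightarrow> real" and p3 p5 \<rho> :: real
  defines "w \<equiv> 2 * (2 * p3 * R 0 - p5 * \<rho>)"
  shows "dri_solution p3 p5 \<rho> (\<lambda>\<tau>. (D \<tau>, R \<tau>, I \<tau>)) \<longleftrightarrow>
    (D 0, R 0, I 0) \<in> S2 \<rho> \<and> (\<forall>\<tau>. R \<tau> = R 0) \<and>
    (\<forall>\<tau>. (D has_real_derivative - w * I \<tau>) (at \<tau>) \<and> (I has_real_derivative w * D \<tau>) (at \<tau>))"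
proof -
  have field: "dri_field p3 p5 \<rho> (D \<tau>, R \<tau>, I \<tau>) = (- w * I \<tau>, 0, w * D \<tau>)" if "R \<tau> = R 0" for \<tau>
    using that by (simp add: dri_field_def w_def algebra_simps)
  have const: "R \<tau> = R 0" if "dri_solution p3 p5 \<rho> (\<lambda>\<tau>. (D \<tau>, R \<tau>, I \<tau>))" for \<tau>
    using that by (intro DERIV_isconst_all)
      (simp add: dri_solution_def dri_field_def has_vector_derivative_triple_iff)
  have R': "(R has_real_derivative 0) (at \<tau>)" if "\<forall>\<tau>. R \<tau> = R 0" for \<tau>
  proof -
    have "R = (\<lambda>_. R 0)"
      using that by auto
    then show ?thesis
      by (metis DERIV_const)
  qed
  show ?thesis
  \<comment> \<open>The field is the rotation field only where \<open>R\<close> has its initial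
    value. If \<open>R\<close> is not constant, both sides are false: the left by
    \<open>const\<close>, the right by its second conjunct.\<close>
  proof (cases "\<forall>\<tau>. R \<tau> = R 0")
    case True
    have "dri_field p3 p5 \<rho> (D \<tau>, R \<tau>, I \<tau>) = (- w * I \<tau>, 0, w * D \<tau>)" for \<tau>
      using True by (intro field) blast
    then have "dri_solution p3 p5 \<rho> (\<lambda>\<tau>. (D \<tau>, R \<tau>, I \<tau>)) \<longleftrightarrow> (D 0, R 0, I 0) \<in> S2 \<rho> \<and>
        (\<forall>\<tau>. (D has_real_derivative - w * I \<tau>) (at \<tau>) \<and> (I has_real_derivative w * D \<tau>) (at \<tau>))"
      by (simp only: dri_solution_def has_vector_derivative_triple_iff R'[OF True] simp_thms)
    with True show ?thesis
      by blast
  qed (use const in blast)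
qed

text \<open>At this height the angular velocity vanishes, since \<open>4 * p3 * R\<close> equals
  \<open>2 * p5 * \<rho>\<close>. The strict inequality keeps the height below
  \<open>\<rho>\<close>, so the parallel has a real radius.\<close>

lemma dri_fixed_point_circle:
  assumes "0 < p5" and "p5 < 2 * p3"
  shows "dri_fixed_point p3 p5 \<rho> (sqrt (1 - (p5 / (2 * p3))\<^sup>2) * \<rho> * cos \<eta>,
    p5 / (2 * p3) * \<rho>, sqrt (1 - (p5 / (2 * p3))\<^sup>2) * \<rho> * sin \<eta>)"
proof -
  define k where "k = p5 / (2 * p3)"
  define s where "s = sqrt (1 - k\<^sup>2)"
  \<comment> \<open>The division is legitimate because the two assumptions force \<open>p3\<close>
    to be positive.\<close>
  have p5: "p5 = 2 * p3 * k"
    using assms by (simp add: k_def)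
  have "0 \<le> k" "k \<le> 1"
    using assms by (auto simp: k_def)
  then have s: "s\<^sup>2 = 1 - k\<^sup>2"
    by (simp add: s_def power_le_one)
  \<comment> \<open>For \<open>c = cos \<eta>\<close> and \<open>d = sin \<eta>\<close> the second
    factor on the right becomes \<open>s\<^sup>2 + k\<^sup>2\<close>, which is 1.\<close>
  have "(s * \<rho> * c)\<^sup>2 + (k * \<rho>)\<^sup>2 + (s * \<rho> * d)\<^sup>2 = \<rho>\<^sup>2 * (s\<^sup>2 * (c\<^sup>2 + d\<^sup>2) + k\<^sup>2)" for c d
    by (simp add: power_mult_distrib algebra_simps)
  then have "(s * \<rho> * cos \<eta>, k * \<rho>, s * \<rho> * sin \<eta>) \<in> S2 \<rho>"
    by (simp add: S2_def s)
  moreover have "dri_field p3 p5 \<rho> (s * \<rho> * cos \<eta>, k * \<rho>, s * \<rho> * sin \<eta>) = 0"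
    by (simp add: dri_field_def p5 zero_prod_def)
  ultimately show ?thesis
    by (simp add: dri_fixed_point_def k_def s_def)
qed

theorem proposition2p24:
  fixes p3 p5 \<rho> :: real
  assumes "p3 > 0" and "p5 > 0" and "\<rho> > 0"
  shows "dri_fixed_point p3 p5 \<rho> (0, \<rho>, 0) \<and> dri_fixed_point p3 p5 \<rho> (- (0, \<rho>, 0)) \<and>
    (2 * p3 > p5 \<longrightarrow>
      (\<forall>P \<in> {(sqrt (1 - (p5 / (2 * p3))\<^sup>2) * \<rho> * cos \<eta>,
              p5 / (2 * p3) * \<rho>,
              sqrt (1 - (p5 / (2 * p3))\<^sup>2) * \<rho> * sin \<eta>) | \<eta> :: real. True}.
        dri_fixed_point p3 p5 \<rho> P)) \<and>
    (\<forall>D R I :: real \<Rightarrow> real.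
      dri_solution p3 p5 \<rho> (\<lambda>\<tau>. (D \<tau>, R \<tau>, I \<tau>)) \<longleftrightarrow>
        (D 0, R 0, I 0) \<in> S2 \<rho> \<and>
        (\<forall>\<tau>. D \<tau> = D 0 * cos (2 * (2 * p3 * R 0 - p5 * \<rho>) * \<tau>)
                  - I 0 * sin (2 * (2 * p3 * R 0 - p5 * \<rho>) * \<tau>) \<and>
             R \<tau> = R 0 \<and>
             I \<tau> = D 0 * sin (2 * (2 * p3 * R 0 - p5 * \<rho>) * \<tau>)
                  + I 0 * cos (2 * (2 * p3 * R 0 - p5 * \<rho>) * \<tau>)))"
proof (intro conjI impI ballI allI)
  show "dri_fixed_point p3 p5 \<rho> (0, \<rho>, 0)" "dri_fixed_point p3 p5 \<rho> (- (0, \<rho>, 0))"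
    by (simp_all add: dri_fixed_point_def S2_def dri_field_def zero_prod_def)
next
  fix P
  assume "2 * p3 > p5" and "P \<in> {(sqrt (1 - (p5 / (2 * p3))\<^sup>2) * \<rho> * cos \<eta>,
      p5 / (2 * p3) * \<rho>, sqrt (1 - (p5 / (2 * p3))\<^sup>2) * \<rho> * sin \<eta>) | \<eta> :: real. True}"
  then show "dri_fixed_point p3 p5 \<rho> P"
    using dri_fixed_point_circle \<open>p5 > 0\<close> by blast
\<comment> \<open>After both rewrites the two sides of the solution formula differ only in the order
  of conjuncts and the placement of the quantifier over time.\<close>
qed (unfold dri_solution_iff rotation_ode_iff, simp only: all_conj_distrib conj_ac)

end
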